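(* Let $\bar\theta=(U,\Sigma)\in\overline{\mathcal M}_{p,k}$. The horizontal space $\mathcal H_{\bar\theta}$ at $\bar\theta$ (the orthogonal complement of the vertical space $\mathcal V_{\bar\theta}$ in $T_{\bar\theta}\overline{\mathcal M}_{p,k}$ with respect to $\langle\cdot,\cdot\rangle_{\bar\theta}$) is $$\mathcal H_{\bar\theta}=\{\bar\xi=(\xi_U,\xi_\Sigma)\in T_{\bar\theta}\overline{\mathcal M}_{p,k}:\ U^H\xi_U=2\alpha(\Sigma^{-1}\xi_\Sigma-\xi_\Sigma\Sigma^{-1})\}.$$ Moreover, the orthogonal projection map $P^{\mathcal H}_{\bar\theta}$ (with respect to $\langle\cdot,\cdot\rangle_{\bar\theta}$) from $T_{\bar\theta}\overline{\mathcal M}_{p,k}$ onto $\mathcal H_{\bar\theta}$ is given, for $\bar\xi=(\xi_U,\xi_\Sigma)\in T_{\bar\theta}\overline{\mathcal M}_{p,k}$, by $$P^{\mathcal H}_{\bar\theta}(\bar\xi)=(\xi_U-U\Omega,\ \xi_\Sigma+\Omega\Sigma-\Sigma\Omega),$$ where $\Omega\in\mathcal H_k^{\perp}$ is the unique solution (in $\mathcal H_k^\perp$) to $$(1-4\alpha)\Omega+2\alpha(\Sigma^{-1}\Omega\Sigma+\Sigma\Omega\Sigma^{-1})=U^H\xi_U+2\alpha(\xi_\Sigma\Sigma^{-1}-\Sigma^{-1}\xi_\Sigma).$$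
   Context: Let $1\le k<p$ be integers. $\mathrm{St}_{p,k}=\{U\in\mathbb C^{p\times k}:U^HU=I_k\}$ is the complex Stiefel manifold, $\mathcal H_k$ the real vector space of $k\times k$ Hermitian matrices, $\mathcal H_k^{++}$ the manifold of Hermitian positive definite $k\times k$ matrices, $\mathcal H_k^\perp$ the space of $k\times k$ skew-Hermitian matrices, $\mathcal U_k$ the unitary group. Let $\overline{\mathcal M}_{p,k}=\mathrm{St}_{p,k}\times\mathcal H_k^{++}$, with tangent space at $\bar\theta=(U,\Sigma)$ $$T_{\bar\theta}\overline{\mathcal M}_{p,k}=\{(\xi_U,\xi_\Sigma)\in\mathbb C^{p\times k}\times\mathcal H_k:\ U^H\xi_U+\xi_U^HU=0\}.$$ For $\alpha>0$ and $\beta>-\alpha/k$, equip it with the Riemannian metric $$\langle\bar\xi,\bar\eta\rangle_{\bar\theta}=\mathrm{Re}\,\mathrm{tr}\big(\xi_U^H(I_p-\tfrac12UU^H)\eta_U\big)+\alpha\,\mathrm{tr}(\Sigma^{-1}\xi_\Sigma\Sigma^{-1}\eta_\Sigma)+\beta\,\mathrm{tr}(\Sigma^{-1}\xi_\Sigma)\,\mathrm{tr}(\Sigma^{-1}\eta_\Sigma).$$ The group $\mathcal U_k$ acts on $\overline{\mathcal M}_{p,k}$ by $(U,\Sigma)\mapsto(UO,O^H\Sigma O)$, $O\in\mathcal U_k$; $\mathcal M_{p,k}$ is the quotient manifold and $\pi:\overline{\mathcal M}_{p,k}\to\mathcal M_{p,k}$ the quotient map. The vertical space at $\bar\theta$ is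 the tangent space to the orbit of $\bar\theta$: $$\mathcal V_{\bar\theta}=\{(U\Omega,\ \Sigma\Omega-\Omega\Sigma):\ \Omega\in\mathcal H_k^\perp\}.$$ *)

theory Defs
  imports "HOL-Analysis.Analysis"
begin

text \<open>
  A complex \<open>p \<times> k\<close> matrix is an element of \<^typ>\<open>complex^'k^'p\<close> with \<open>p = CARD('p)\<close>
  rows and \<open>k = CARD('k)\<close> columns.
\<close>

definition conj_transpose :: "complex^'n^'m \<Rightarrow> complex^'m^'n" where
  "conj_transpose A = (\<chi> i j. cnj (A $ j $ i))"

definition stiefel :: "(complex^'k^'p) set" where
  "stiefel = {U. conj_transpose U ** U = mat 1}"

definition hermitian :: "(complex^'k^'k) set" where
  "hermitian = {A. conj_transpose A = A}"

definition skew_hermitian :: "(complex^'k^'k) set" where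
  "skew_hermitian = {A. conj_transpose A = - A}"

text \<open>The quadratic form \<open>x\<^sup>H S x\<close> is real for Hermitian \<open>S\<close>, so taking \<open>Re\<close> loses nothing.\<close>

definition hermitian_posdef :: "(complex^'k^'k) set" where
  "hermitian_posdef =
     {S \<in> hermitian. \<forall>x. x \<noteq> 0 \<longrightarrow> 0 < Re (\<Sum>i\<in>UNIV. cnj (x $ i) * (S *v x) $ i)}"

definition total_space :: "((complex^'k^'p) \<times> (complex^'k^'k)) set" where
  "total_space = stiefel \<times> hermitian_posdef"

definition tangent_space ::
  "(complex^'k^'p) \<times> (complex^'k^'k) \<Rightarrow> ((complex^'k^'p) \<times> (complex^'k^'k)) set" where
  "tangent_space = (\<lambda>(U, S).
     {(\<xi>U, \<xi>S). \<xi>S \<in> hermitian \<and> conj_transpose U ** \<xi>U + conj_transpose \<xi>U ** U = 0})"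

text \<open>
  On tangent vectors all traces in the last two summands are real: they are traces of a product
  of two Hermitian matrices, up to cyclic permutation. Hence \<open>Re\<close> there only serves to obtain a
  value of type \<^typ>\<open>real\<close>.
\<close>

definition stiefel_hpd_metric ::
  "real \<Rightarrow> real \<Rightarrow> (complex^'k^'p) \<times> (complex^'k^'k) \<Rightarrow>
   (complex^'k^'p) \<times> (complex^'k^'k) \<Rightarrow> (complex^'k^'p) \<times> (complex^'k^'k) \<Rightarrow> real" where
  "stiefel_hpd_metric \<alpha> \<beta> = (\<lambda>(U, S) (\<xi>U, \<xi>S) (\<eta>U, \<eta>S).
     Re (trace (conj_transpose \<xi>U ** (mat 1 - (1/2) *\<^sub>R (U ** conj_transpose U)) ** \<eta>U))
     + \<alpha> * Re (trace (matrix_inv S ** \<xi>S ** matrix_inv S ** \<eta>S))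
     + \<beta> * (Re (trace (matrix_inv S ** \<xi>S)) * Re (trace (matrix_inv S ** \<eta>S))))"

text \<open>
  The tangent space at \<open>(U, S)\<close> of the orbit under \<open>(U, S) \<mapsto> (U O, O\<^sup>H S O)\<close>, \<open>O\<close> unitary:
  differentiate at \<open>O = I\<close> in the direction of a skew-Hermitian \<open>\<Omega>\<close>.
\<close>

definition vertical_space ::
  "(complex^'k^'p) \<times> (complex^'k^'k) \<Rightarrow> ((complex^'k^'p) \<times> (complex^'k^'k)) set" where
  "vertical_space = (\<lambda>(U, S). {(U ** \<Omega>, S ** \<Omega> - \<Omega> ** S) | \<Omega>. \<Omega> \<in> skew_hermitian})"

definition horizontal_space ::
  "real \<Rightarrow> real \<Rightarrow> (complex^'k^'p) \<times> (complex^'k^'k) \<Rightarrow>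
   ((complex^'k^'p) \<times> (complex^'k^'k)) set" where
  "horizontal_space \<alpha> \<beta> \<theta> =
     {\<xi> \<in> tangent_space \<theta>. \<forall>\<eta> \<in> vertical_space \<theta>. stiefel_hpd_metric \<alpha> \<beta> \<theta> \<xi> \<eta> = 0}"

text \<open>
  \<open>P\<close> is the orthogonal projection of \<open>T\<close> onto \<open>V \<subseteq> T\<close> with respect to the form \<open>g\<close>.
  Only the values of \<open>P\<close> on \<open>T\<close> matter.
\<close>

definition is_orthogonal_projection ::
  "('a::real_vector \<Rightarrow> 'a \<Rightarrow> real) \<Rightarrow> 'a set \<Rightarrow> 'a set \<Rightarrow> ('a \<Rightarrow> 'a) \<Rightarrow> bool" where
  "is_orthogonal_projection g T V P \<longleftrightarrow>
     P ` T = V \<and> (\<forall>\<xi>\<in>T. \<forall>\<eta>\<in>V. g (\<xi> - P \<xi>) \<eta> = 0)"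

end

theory Submission
  imports Defs
begin

text \<open>
  For a tangent vector \<open>\<xi> = (X, A)\<close> and \<open>T = S\<inverse>\<close>, pairing \<open>\<xi>\<close> with the vertical vector of \<open>\<Omega>\<close>
  gives \<open>- 1/2 Re tr (B \<Omega>)\<close> with the skew-Hermitian matrix \<open>B = U\<^sup>H X - 2\<alpha> (T A - A T)\<close>, so \<open>\<xi>\<close> is
  horizontal iff \<open>B = 0\<close>. The operator \<open>L\<close> of the equation for \<open>\<Omega>\<close> satisfies
  \<open>\<langle>\<Omega>, L \<Omega>\<rangle> = \<parallel>\<Omega>\<parallel>\<^sup>2 + 2\<alpha> tr (T C\<^sup>H T C)\<close> with \<open>C = \<Omega> S - S \<Omega>\<close>, hence is injective, hence bijective, on
  all matrices; since it commutes with the adjoint, the solution for a skew-Hermitian right-hand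
  side is skew-Hermitian. Uniqueness of the projection is positive definiteness of the metric,
  where \<open>\<beta> > -\<alpha>/k\<close> enters through \<open>(tr (T A))\<^sup>2 \<le> k tr (T A T A)\<close>.
\<close>

section \<open>Trace of a positive definite times a positive semidefinite matrix\<close>

text \<open>Eliminating one index splits \<open>P\<close> into a Schur complement, positive definite
  on the remaining indices, and a rank-one matrix whose pairing with \<open>Q\<close> is a positive
  multiple of a value of the quadratic form of \<open>Q\<close>. Sums over an arbitrary finite index
  set, instead of matrices of a fixed type, allow this induction on the dimension.\<close>

lemma Re_sum_posdef_mult_nonneg:
  fixes P Q :: "'i \<Rightarrow> 'i \<Rightarrow> complex"
  assumes "finite I"
    and "\<And>i j. i \<in> I \<Longrightarrow> j \<in> I \<Longrightarrow> P j i = cnj (P i j)"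
    and "\<And>x. \<exists>i\<in>I. x i \<noteq> 0 \<Longrightarrow> 0 < Re (\<Sum>i\<in>I. \<Sum>j\<in>I. cnj (x i) * P i j * x j)"
    and "\<And>x. 0 \<le> Re (\<Sum>i\<in>I. \<Sum>j\<in>I. cnj (x i) * Q i j * x j)"
  shows "0 \<le> Re (\<Sum>i\<in>I. \<Sum>j\<in>I. P i j * Q j i)"
  using assms
proof (induction I arbitrary: P rule: finite_induct)
  case empty
  then show ?case by simp
next
  case (insert a I)
  note herm = insert.prems(1) and pos = insert.prems(2) and psd = insert.prems(3)
  have neq: "i \<noteq> a" if "i \<in> I" for i
    using insert.hyps that by auto
  have row_a: "cnj (P i a) = P a i" if "i \<in> insert a I" for i
    using herm[of i a] that by simp
  define p where "p = P a a"
  \<comment> \<open>The Schur complement of \<open>P a a\<close>, so that \<open>P\<close> is \<open>R\<close> plus a rank-one matrix.\<close>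
  define R where "R i j = P i j - P i a * P a j / p" for i j
  have p_real: "p = of_real (Re p)"
    using herm[of a a] by (simp add: p_def complex_eq_iff)
  \<comment> \<open>The unit vector at \<open>a\<close> extracts the pivot from the quadratic form,
    which makes it positive.\<close>
  have "(\<Sum>i\<in>insert a I. \<Sum>j\<in>insert a I.
           cnj (if i = a then 1 else 0) * P i j * (if j = a then 1 else 0)) = p"
    using insert.hyps neq by (simp add: p_def cong: sum.cong_simp)
  then have p_pos: "Re p > 0"
    using pos[of "\<lambda>i. if i = a then 1 else 0"] by (auto cong: sum.cong_simp)
  then have p_nz: "p \<noteq> 0" by auto
  have R_zero: "R a i = 0" "R i a = 0" for i
    using p_nz by (simp_all add: R_def p_def)
  have R_sum: "(\<Sum>i\<in>insert a I. \<Sum>j\<in>insert a I. f i j * R i j) = (\<Sum>i\<in>I. \<Sum>j\<in>I. f i j * R i j)"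
    for f
    using insert.hyps by (simp add: R_zero)
  have P_split: "P i j = R i j + P i a * P a j / p" for i j
    by (simp add: R_def)
  have "0 \<le> Re (\<Sum>i\<in>I. \<Sum>j\<in>I. R i j * Q j i)"
  proof (rule insert.IH)
    fix i j assume "i \<in> I" "j \<in> I"
    then show "R j i = cnj (R i j)"
      using herm[of i j] herm[of i a] herm[of a j] p_real
      by (simp add: R_def) (metis complex_cnj_complex_of_real mult.commute)
  next
    fix x :: "'i \<Rightarrow> complex" assume x: "\<exists>i\<in>I. x i \<noteq> 0"
    \<comment> \<open>The coordinate at \<open>a\<close> is chosen so that row \<open>a\<close> of
      \<open>P\<close> annihilates \<open>y\<close>. The rank-one part then contributes nothing, and
      the form of \<open>P\<close> at \<open>y\<close> equals that of \<open>R\<close> at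
      \<open>x\<close>.\<close>
    define y where "y = x(a := - (\<Sum>j\<in>I. P a j * x j) / p)"
    have y_I: "y i = x i" if "i \<in> I" for i
      using neq[OF that] by (simp add: y_def)
    have y_a: "(\<Sum>j\<in>insert a I. P a j * y j) = 0"
      using insert.hyps p_nz y_I by (simp add: p_def[symmetric] cong: sum.cong_simp) (simp add: y_def)
    have "(\<Sum>i\<in>insert a I. \<Sum>j\<in>insert a I. cnj (y i) * P i j * y j)
        = (\<Sum>i\<in>insert a I. \<Sum>j\<in>insert a I. (cnj (y i) * y j) * R i j)
          + (\<Sum>i\<in>insert a I. cnj (y i) * P i a / p * (\<Sum>j\<in>insert a I. P a j * y j))"
      unfolding sum_distrib_left sum.distrib[symmetric]
      by (intro sum.cong refl) (subst P_split, simp add: algebra_simps)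
    also have "\<dots> = (\<Sum>i\<in>I. \<Sum>j\<in>I. cnj (x i) * R i j * x j)"
      unfolding y_a R_sum using y_I by (simp add: mult_ac cong: sum.cong_simp)
    finally show "0 < Re (\<Sum>i\<in>I. \<Sum>j\<in>I. cnj (x i) * R i j * x j)"
      using pos[of y] x y_I by (metis insertI2)
  next
    fix x :: "'i \<Rightarrow> complex"
    show "0 \<le> Re (\<Sum>i\<in>I. \<Sum>j\<in>I. cnj (x i) * Q i j * x j)"
      using psd[of "x(a := 0)"] insert.hyps neq by (simp cong: sum.cong_simp)
  qed
  \<comment> \<open>The rank-one part of \<open>P\<close> is built from column \<open>a\<close>, so
    its pairing with \<open>Q\<close> is the form of \<open>Q\<close> at that column, divided by the
    pivot.\<close>
  moreover have "0 \<le> Re (\<Sum>i\<in>insert a I. \<Sum>j\<in>insert a I. cnj (P i a) * Q i j * P j a)"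
    by (rule psd)
  moreover have "(\<Sum>i\<in>insert a I. \<Sum>j\<in>insert a I. P i j * Q j i)
      = (\<Sum>i\<in>I. \<Sum>j\<in>I. R i j * Q j i)
        + (\<Sum>i\<in>insert a I. \<Sum>j\<in>insert a I. cnj (P i a) * Q i j * P j a) / of_real (Re p)"
  proof -
    have "(\<Sum>i\<in>insert a I. \<Sum>j\<in>insert a I. P i j * Q j i)
      = (\<Sum>i\<in>insert a I. \<Sum>j\<in>insert a I. Q j i * R i j)
        + (\<Sum>i\<in>insert a I. \<Sum>j\<in>insert a I. P a j * Q j i * P i a / p)"
      unfolding sum.distrib[symmetric]
      by (intro sum.cong refl) (subst P_split, simp add: algebra_simps)
    also have "(\<Sum>i\<in>insert a I. \<Sum>j\<in>insert a I. P a j * Q j i * P i a / p)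
      = (\<Sum>i\<in>insert a I. \<Sum>j\<in>insert a I. cnj (P i a) * Q i j * P j a) / p"
      unfolding sum_divide_distrib
      by (subst sum.swap) (intro sum.cong refl, simp add: row_a)
    finally show ?thesis
      unfolding R_sum using p_real by (simp add: mult.commute)
  qed
  ultimately show ?case
    using p_pos by (simp only: plus_complex.sel Re_divide_of_real) simp
qed

section \<open>Adjoints, traces and the Frobenius inner product\<close>

lemma conj_transpose_simps [simp]:
  fixes A B :: "complex^'n^'m"
  shows "conj_transpose (conj_transpose A) = A"
    and "conj_transpose (A + B) = conj_transpose A + conj_transpose B"
    and "conj_transpose (A - B) = conj_transpose A - conj_transpose B"
    and "conj_transpose (- A) = - conj_transpose A"
    and "conj_transpose (c *\<^sub>R A) = c *\<^sub>R conj_transpose A"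
    and "conj_transpose (0 :: complex^'n^'m) = 0"
    and "conj_transpose (mat 1 :: complex^'n^'n) = mat 1"
  by (simp_all add: conj_transpose_def vec_eq_iff mat_def)

lemma conj_transpose_mult [simp]:
  "conj_transpose (A ** B) = conj_transpose B ** conj_transpose A"
  by (simp add: conj_transpose_def matrix_matrix_mult_def vec_eq_iff mult.commute)

lemma trace_conj_transpose: "trace (conj_transpose A) = cnj (trace A)" for A :: "complex^'n^'n"
  by (simp add: trace_def conj_transpose_def)

text \<open>The Euclidean inner product on matrices is the real Frobenius product; its definiteness
  turns vanishing traces into vanishing matrices.\<close>

lemma inner_matrix_eq_Re_trace: "inner A B = Re (trace (conj_transpose A ** B))"
  for A B :: "complex^'n^'m"
  unfolding trace_def conj_transpose_def matrix_matrix_mult_def inner_vec_def inner_complex_def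
  by (simp, rule sum.swap)

lemma inner_vector_eq_Re_sum: "inner x y = Re (\<Sum>i\<in>UNIV. cnj (x $ i) * y $ i)"
  for x y :: "complex^'n"
  by (simp add: inner_vec_def inner_complex_def)

lemma inner_conj_transpose: "inner (A *v x) y = inner x (conj_transpose A *v y)"
  for A :: "complex^'n^'m"
proof -
  have "(\<Sum>i\<in>UNIV. cnj ((A *v x) $ i) * y $ i) = (\<Sum>i\<in>UNIV. cnj (x $ i) * (conj_transpose A *v y) $ i)"
    unfolding matrix_vector_mult_def conj_transpose_def
    by (simp add: sum_distrib_left sum_distrib_right) (subst sum.swap, simp add: mult_ac)
  then show ?thesis
    by (simp only: inner_vector_eq_Re_sum)
qed

lemma hermitian_posdef_iff:
  "S \<in> hermitian_posdef \<longleftrightarrow> conj_transpose S = S \<and> (\<forall>x. x \<noteq> 0 \<longrightarrow> 0 < inner x (S *v x))"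
  unfolding hermitian_posdef_def hermitian_def inner_vector_eq_Re_sum by blast

lemma Re_trace_posdef_mult_nonneg:
  assumes S: "S \<in> hermitian_posdef" and Q: "\<And>x. 0 \<le> inner x (Q *v x)"
  shows "0 \<le> Re (trace (S ** Q))"
proof -
  have quad: "inner (\<chi> i. x i) (A *v (\<chi> i. x i)) = Re (\<Sum>i\<in>UNIV. \<Sum>j\<in>UNIV. cnj (x i) * A $ i $ j * x j)"
    for A :: "complex^'a^'a" and x
    by (simp add: inner_vector_eq_Re_sum matrix_vector_mult_def sum_distrib_left mult_ac)
  have "0 \<le> Re (\<Sum>i\<in>UNIV. \<Sum>j\<in>UNIV. S $ i $ j * Q $ j $ i)"
  proof (rule Re_sum_posdef_mult_nonneg)
    fix i j show "S $ j $ i = cnj (S $ i $ j)"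
      using S by (auto simp: hermitian_posdef_def hermitian_def conj_transpose_def vec_eq_iff)
  next
    fix x :: "'a \<Rightarrow> complex" assume "\<exists>i\<in>UNIV. x i \<noteq> 0"
    then have "(\<chi> i. x i) \<noteq> 0" by (simp add: vec_eq_iff)
    then show "0 < Re (\<Sum>i\<in>UNIV. \<Sum>j\<in>UNIV. cnj (x i) * S $ i $ j * x j)"
      using S unfolding quad[symmetric] hermitian_posdef_iff by blast
  next
    fix x show "0 \<le> Re (\<Sum>i\<in>UNIV. \<Sum>j\<in>UNIV. cnj (x i) * Q $ i $ j * x j)"
      using Q unfolding quad[symmetric] by simp
  qed simp
  then show ?thesis
    by (simp add: trace_def matrix_matrix_mult_def)
qed

lemma matrix_mult_distribs:
  fixes A B :: "complex^'n^'m"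
  shows "(A - B) ** C = A ** C - B ** C" and "D ** (A - B) = D ** A - D ** B"
    and "(- A) ** C = - (A ** C)" and "D ** (- A) = - (D ** A)"
    and "(A + B) ** C = A ** C + B ** C" and "D ** (A + B) = D ** A + D ** B"
    and "(c *\<^sub>R A) ** C = c *\<^sub>R (A ** C)" and "D ** (c *\<^sub>R A) = c *\<^sub>R (D ** A)"
    and "0 ** C = (0 :: complex^'l^'m)" and "D ** 0 = (0 :: complex^'n^'k)"
  by (vector matrix_matrix_mult_def sum_subtractf sum_negf sum.distrib algebra_simps scaleR_sum_right)+

lemma trace_scaleR: "trace (c *\<^sub>R A) = c *\<^sub>R trace A" for A :: "complex^'n^'n"
  by (simp add: trace_def scaleR_sum_right)

lemma trace_uminus: "trace (- A) = - trace A" for A :: "complex^'n^'n"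
  by (simp add: trace_def sum_negf)

section \<open>Inverses of positive definite matrices\<close>

lemma posdef_invertible:
  assumes "S \<in> hermitian_posdef" shows "invertible S"
proof -
  have "x = 0" if "S *v x = 0" for x
    using assms that by (auto simp: hermitian_posdef_def)
  then show ?thesis
    unfolding invertible_left_inverse matrix_left_invertible_ker by blast
qed

lemma matrix_inv_posdef_cancel:
  assumes "S \<in> hermitian_posdef"
  shows "matrix_inv S ** S = mat 1" "S ** matrix_inv S = mat 1"
  using posdef_invertible[OF assms] someI_ex[of "\<lambda>B. S ** B = mat 1 \<and> B ** S = mat 1"]
  unfolding invertible_def matrix_inv_def by blast+

text \<open>The adjoint of the inverse is a left inverse of \<open>S\<close>, hence the inverse
  itself. Substituting x = S y turns the form of the inverse at x into the form of \<open>S\<close>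
  at y.\<close>

lemma matrix_inv_posdef:
  assumes S: "S \<in> hermitian_posdef" shows "matrix_inv S \<in> hermitian_posdef"
proof -
  note inv = matrix_inv_posdef_cancel[OF S]
  have SH: "conj_transpose S = S"
    using S by (simp add: hermitian_posdef_iff)
  have "conj_transpose (matrix_inv S) ** S = mat 1"
    by (metis SH inv(2) conj_transpose_mult conj_transpose_simps(7))
  then have TH: "conj_transpose (matrix_inv S) = matrix_inv S"
    by (metis inv(2) matrix_mul_assoc matrix_mul_lid matrix_mul_rid)
  moreover have "0 < inner x (matrix_inv S *v x)" if "x \<noteq> 0" for x
  proof -
    let ?y = "matrix_inv S *v x"
    have Sy: "S *v ?y = x"
      by (simp add: matrix_vector_mul_assoc inv)
    with that have "?y \<noteq> 0" by auto
    then have "0 < inner ?y (S *v ?y)"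
      using S by (simp add: hermitian_posdef_iff)
    then show ?thesis by (simp add: Sy inner_commute)
  qed
  ultimately show ?thesis
    by (simp add: hermitian_posdef_iff)
qed

text \<open>The form of C^H T C at x is that of \<open>T\<close> at C x, so C^H T C is positive
  semidefinite and its product with \<open>T\<close> has nonnegative trace.\<close>

lemma Re_trace_conj_posdef_nonneg:
  assumes T: "T \<in> hermitian_posdef"
  shows "0 \<le> Re (trace (T ** conj_transpose C ** T ** C))"
proof -
  have psd: "0 \<le> inner y (T *v y)" for y
    using T by (cases "y = 0") (auto simp: hermitian_posdef_iff less_imp_le)
  have "0 \<le> Re (trace (T ** (conj_transpose C ** T ** C)))"
  proof (rule Re_trace_posdef_mult_nonneg[OF T])
    show "0 \<le> inner x ((conj_transpose C ** T ** C) *v x)" for x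
      using psd[of "C *v x"] by (simp add: inner_conj_transpose matrix_vector_mul_assoc matrix_mul_assoc)
  qed
  then show ?thesis by (simp add: matrix_mul_assoc)
qed

section \<open>A point of the total space and the operator of the equation for \<Omega>\<close>

locale stiefel_hpd_point =
  fixes U :: "complex^'k^'p" and S :: "complex^'k^'k" and \<alpha> \<beta> :: real
  assumes total: "(U, S) \<in> total_space"
    and alpha_pos: "\<alpha> > 0" and beta_gt: "\<beta> > - \<alpha> / real CARD('k)"
begin

abbreviation T :: "complex^'k^'k" where "T \<equiv> matrix_inv S"

abbreviation g where "g \<equiv> stiefel_hpd_metric \<alpha> \<beta> (U, S)"

definition L :: "complex^'k^'k \<Rightarrow> complex^'k^'k" where
  "L \<Omega> = (1 - 4 * \<alpha>) *\<^sub>R \<Omega> + (2 * \<alpha>) *\<^sub>R (T ** \<Omega> ** S + S ** \<Omega> ** T)"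

lemma S_posdef: "S \<in> hermitian_posdef" and U_stiefel: "conj_transpose U ** U = mat 1"
  using total by (auto simp: total_space_def stiefel_def)

lemma T_posdef: "T \<in> hermitian_posdef"
  by (rule matrix_inv_posdef[OF S_posdef])

lemma adjoints [simp]: "conj_transpose S = S" "conj_transpose T = T"
  using S_posdef T_posdef by (simp_all add: hermitian_posdef_iff)

lemma cancels [simp]:
  "T ** S = mat 1" "S ** T = mat 1" "conj_transpose U ** U = mat 1"
  "T ** (S ** A) = A" "S ** (T ** A) = A" "conj_transpose U ** (U ** A) = A"
  by (simp_all add: matrix_inv_posdef_cancel[OF S_posdef] U_stiefel matrix_mul_assoc)

text \<open>Normal form for products: sums are distributed and factors nested to the right, where
  the rules \<open>cancels\<close> can remove neighbouring inverse factors.\<close>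

lemmas expand = matrix_mult_distribs matrix_mul_assoc[symmetric]
  trace_add trace_sub trace_scaleR trace_uminus

text \<open>With C = \<Omega> S - S \<Omega>, two of the four terms of tr (T C^H T C) cancel to -tr
  (\<Omega>^H \<Omega>) each, one directly and one after a cyclic shift. They account for the
  coefficient -4\<alpha> in \<open>L\<close>, so positivity holds for large \<alpha> too.\<close>

lemma inner_L:
  "inner \<Omega> (L \<Omega>) = inner \<Omega> \<Omega>
     + 2 * \<alpha> * Re (trace (T ** conj_transpose (\<Omega> ** S - S ** \<Omega>) ** T ** (\<Omega> ** S - S ** \<Omega>)))"
proof -
  have "trace (T ** (conj_transpose \<Omega> ** (\<Omega> ** S))) = trace (conj_transpose \<Omega> ** \<Omega>)"
    "trace (T ** (conj_transpose \<Omega> ** (S ** \<Omega>))) = trace (conj_transpose \<Omega> ** (S ** (\<Omega> ** T)))"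
    using trace_mul_sym[of T "conj_transpose \<Omega> ** (\<Omega> ** S)"]
      trace_mul_sym[of T "conj_transpose \<Omega> ** (S ** \<Omega>)"] by (simp_all add: expand)
  then show ?thesis
    by (simp add: inner_matrix_eq_Re_trace L_def expand algebra_simps)
qed

lemma linear_L: "linear L"
  by (rule linearI) (simp_all add: L_def expand algebra_simps)

lemma bij_L: "bij L"
proof -
  have "\<Omega> = 0" if "L \<Omega> = 0" for \<Omega>
  proof -
    have "inner \<Omega> \<Omega> \<le> inner \<Omega> (L \<Omega>)"
      unfolding inner_L using alpha_pos
      by (simp add: Re_trace_conj_posdef_nonneg[OF T_posdef] del: conj_transpose_simps conj_transpose_mult)
    with that show ?thesis
      by (metis inner_eq_zero_iff inner_ge_zero inner_zero_right order_antisym)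
  qed
  then have "inj L"
    using linear_L by (simp add: linear_injective_0)
  then show ?thesis
    using linear_L by (simp add: bij_def linear_injective_imp_surjective)
qed

lemma conj_transpose_L: "conj_transpose (L \<Omega>) = L (conj_transpose \<Omega>)"
  by (simp add: L_def expand algebra_simps)

lemma ex1_skew_hermitian_L:
  assumes "B \<in> skew_hermitian"
  shows "\<exists>!\<Omega>. \<Omega> \<in> skew_hermitian \<and> L \<Omega> = B"
proof -
  obtain \<Omega> where \<Omega>: "L \<Omega> = B" using bij_L by (metis bij_pointE)
  \<comment> \<open>Since \<open>B\<close> is skew-Hermitian, -\<Omega>^H solves the same equation
    as \<Omega>, and injectivity identifies the two.\<close>
  have "L (- conj_transpose \<Omega>) = - L (conj_transpose \<Omega>)"
    using linear_L by (rule linear_neg)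
  also have "\<dots> = L \<Omega>"
    using \<Omega> assms by (simp add: conj_transpose_L[symmetric] skew_hermitian_def)
  finally have "\<Omega> \<in> skew_hermitian"
    using bij_L unfolding skew_hermitian_def mem_Collect_eq by (metis bij_def injD minus_minus)
  then show ?thesis
    using \<Omega> bij_L by (metis bij_def injD)
qed

section \<open>Tangent vectors and the horizontal space\<close>

lemma tangentD:
  assumes "(X, A) \<in> tangent_space (U, S)"
  shows "conj_transpose A = A" "conj_transpose X ** U = - (conj_transpose U ** X)"
    "conj_transpose U ** X \<in> skew_hermitian"
  using assms by (auto simp: tangent_space_def hermitian_def skew_hermitian_def eq_neg_iff_add_eq_0 add.commute)

lemma tangentI:
  assumes "conj_transpose A = A" "conj_transpose X ** U = - (conj_transpose U ** X)"
  shows "(X, A) \<in> tangent_space (U, S)"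
  using assms by (simp add: tangent_space_def hermitian_def)

text \<open>The factor 1/2 comes from (I - 1/2 U U^H) U = 1/2 U, and the sign from X^H U = -U^H X.
  The \<beta> summand vanishes because tr (T (S \<Omega> - \<Omega> S)) = 0 by cyclicity.\<close>

lemma metric_vertical:
  assumes "(X, A) \<in> tangent_space (U, S)"
  shows "g (X, A) (U ** \<Omega>, S ** \<Omega> - \<Omega> ** S)
    = - (1/2) * Re (trace ((conj_transpose U ** X - (2 * \<alpha>) *\<^sub>R (T ** A - A ** T)) ** \<Omega>))"
proof -
  note tangentD[OF assms, simp]
  have U_part: "conj_transpose X ** (U ** \<Omega>) = - (conj_transpose U ** (X ** \<Omega>))"
    by (simp add: matrix_mul_assoc matrix_mult_distribs)
  have "trace (T ** (A ** (T ** (\<Omega> ** S)))) = trace (A ** (T ** \<Omega>))"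
    "trace (T ** (\<Omega> ** S)) = trace \<Omega>"
    using trace_mul_sym[of T "A ** (T ** (\<Omega> ** S))"] trace_mul_sym[of T "\<Omega> ** S"]
    by (simp_all add: expand)
  then show ?thesis
    by (simp add: stiefel_hpd_metric_def expand U_part algebra_simps)
qed

lemma horizontal_iff:
  "(X, A) \<in> horizontal_space \<alpha> \<beta> (U, S) \<longleftrightarrow>
     (X, A) \<in> tangent_space (U, S) \<and> conj_transpose U ** X = (2 * \<alpha>) *\<^sub>R (T ** A - A ** T)"
proof (cases "(X, A) \<in> tangent_space (U, S)")
  case True
  let ?B = "conj_transpose U ** X - (2 * \<alpha>) *\<^sub>R (T ** A - A ** T)"
  have skew: "conj_transpose ?B = - ?B"
    using tangentD[OF True] by (simp add: expand algebra_simps)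
  have "?B = 0" if "\<And>\<Omega>. \<Omega> \<in> skew_hermitian \<Longrightarrow> g (X, A) (U ** \<Omega>, S ** \<Omega> - \<Omega> ** S) = 0"
  proof -
    \<comment> \<open>The skew-Hermitian matrix \<open>?B\<close> itself serves as test direction,
      since tr (B B) = -tr (B^H B).\<close>
    have "Re (trace (?B ** ?B)) = 0"
      using that[of ?B] skew unfolding metric_vertical[OF True] by (simp add: skew_hermitian_def)
    then have "inner ?B ?B = 0"
      unfolding inner_matrix_eq_Re_trace skew matrix_mult_distribs(3) trace_uminus by simp
    then show ?thesis by simp
  qed
  moreover have "g (X, A) (U ** \<Omega>, S ** \<Omega> - \<Omega> ** S) = 0" if "?B = 0" for \<Omega>
    unfolding metric_vertical[OF True] that by (simp add: matrix_mult_distribs trace_def)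
  ultimately show ?thesis
    using True by (auto simp: horizontal_space_def vertical_space_def)
qed (simp add: horizontal_space_def)


section \<open>Symmetry and positive definiteness of the metric\<close>

lemma metric_sym: "g \<xi> \<eta> = g \<eta> \<xi>"
proof -
  obtain X A Y B where [simp]: "\<xi> = (X, A)" "\<eta> = (Y, B)" by fastforce
  have cyc: "trace (T ** (A ** (T ** B))) = trace (T ** (B ** (T ** A)))"
    using trace_mul_sym[of "T ** A" "T ** B"] by (simp add: matrix_mul_assoc)
  let ?M = "mat 1 - (1/2) *\<^sub>R (U ** conj_transpose U)"
  \<comment> \<open>As \<open>?M\<close> is Hermitian, exchanging \<open>X\<close> and
    \<open>Y\<close> conjugates the trace and keeps its real part.\<close>
  have "conj_transpose (conj_transpose X ** ?M ** Y) = conj_transpose Y ** ?M ** X"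
    by (simp add: matrix_mul_assoc)
  then have "trace (conj_transpose Y ** ?M ** X) = cnj (trace (conj_transpose X ** ?M ** Y))"
    using trace_conj_transpose[of "conj_transpose X ** ?M ** Y"] by argo
  then show ?thesis
    using cyc by (simp add: stiefel_hpd_metric_def matrix_mul_assoc)
qed

lemma metric_diff_left: "g (\<xi> - \<xi>') \<eta> = g \<xi> \<eta> - g \<xi>' \<eta>"
  by (cases \<xi>; cases \<xi>'; cases \<eta>) (simp add: stiefel_hpd_metric_def expand diff_divide_distrib algebra_simps)

lemma Re_trace_TATA_nonneg:
  assumes "conj_transpose A = A"
  shows "0 \<le> Re (trace (T ** (A ** (T ** A))))"
  using Re_trace_conj_posdef_nonneg[OF T_posdef, of A] assms by (simp add: matrix_mul_assoc)

text \<open>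
  The form \<open>h A = Re tr (T A T A)\<close> is nonnegative, so a zero \<open>A\<close> of it lies in its kernel; pairing \<open>A\<close>
  with \<open>S A S\<close> yields \<open>\<parallel>A\<parallel>\<^sup>2 = 0\<close>.
\<close>

lemma Re_trace_TATA_eq_0:
  assumes A: "conj_transpose A = A" and zero: "Re (trace (T ** (A ** (T ** A)))) = 0"
  shows "A = 0"
proof -
  let ?m = "inner A A" and ?B = "S ** (A ** S)"
  define q where "q = Re (trace (T ** (?B ** (T ** ?B))))"
  have m: "Re (trace (A ** A)) = ?m"
    using A by (simp add: inner_matrix_eq_Re_trace)
  have cyc: "trace (T ** (A ** (A ** S))) = trace (A ** A)"
    using trace_mul_sym[of T "A ** (A ** S)"] by (simp add: expand)
  have quadratic: "0 \<le> 2 * t * ?m + t\<^sup>2 * q" for t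
  proof -
    have "Re (trace (T ** ((A + t *\<^sub>R ?B) ** (T ** (A + t *\<^sub>R ?B))))) = 2 * t * ?m + t\<^sup>2 * q"
      using cyc m zero by (simp add: expand q_def power2_eq_square algebra_simps)
    moreover have "conj_transpose (A + t *\<^sub>R ?B) = A + t *\<^sub>R ?B"
      using A by (simp add: matrix_mul_assoc)
    ultimately show ?thesis
      using Re_trace_TATA_nonneg by metis
  qed
  have "0 \<le> q"
    unfolding q_def using A by (intro Re_trace_TATA_nonneg) (simp add: matrix_mul_assoc)
  have "?m = 0"
  proof (rule ccontr)
    assume "?m \<noteq> 0"
    then have "?m > 0" by (metis inner_ge_zero less_eq_real_def)
    \<comment> \<open>A negative t so small that t q \<ge> -m, whence 2 m + t q \<ge> m > 0 and the
      quadratic becomes negative. The summand 1 keeps the denominator positive when q = 0.\<close>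
    define t where "t = - ?m / (q + 1)"
    have "t < 0" and "t * q \<ge> - ?m"
      using \<open>?m > 0\<close> \<open>0 \<le> q\<close> by (simp_all add: t_def field_simps)
    then have "t * (2 * ?m + t * q) < 0"
      using \<open>?m > 0\<close> by (intro mult_neg_pos) linarith+
    then show False
      using quadratic[of t] by (simp add: power2_eq_square algebra_simps)
  qed
  then show ?thesis by simp
qed

text \<open>This is Cauchy-Schwarz for the form (A, B) \<mapsto> Re tr (T A T B) with B = S: the
  pairing of \<open>A\<close> with \<open>S\<close> is Re tr (T A), and that of \<open>S\<close>
  with itself is tr I = k.\<close>

lemma Re_trace_TA_square_le:
  assumes A: "conj_transpose A = A"
  shows "(Re (trace (T ** A)))\<^sup>2 \<le> real CARD('k) * Re (trace (T ** (A ** (T ** A))))"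
proof -
  \<comment> \<open>The coefficient of the projection of \<open>A\<close> onto \<open>S\<close>; it
    makes A - c S orthogonal to \<open>S\<close> for this form.\<close>
  define c where "c = Re (trace (T ** A)) / real CARD('k)"
  have s: "Re (trace (T ** A)) = c * real CARD('k)"
    by (simp add: c_def)
  have "0 \<le> Re (trace (T ** ((A - c *\<^sub>R S) ** (T ** (A - c *\<^sub>R S)))))"
    using A by (intro Re_trace_TATA_nonneg) simp
  also have "\<dots> = Re (trace (T ** (A ** (T ** A)))) - c\<^sup>2 * real CARD('k)"
    by (simp add: expand trace_I) (simp add: s power2_eq_square algebra_simps)
  finally have "real CARD('k) * (c\<^sup>2 * real CARD('k)) \<le> real CARD('k) * Re (trace (T ** (A ** (T ** A))))"
    by (intro mult_left_mono) auto
  then show ?thesis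
    unfolding s by (simp add: power2_eq_square mult_ac)
qed

lemma metric_posdef:
  assumes tangent: "\<xi> \<in> tangent_space (U, S)" and zero: "g \<xi> \<xi> = 0"
  shows "\<xi> = 0"
proof -
  obtain X A where \<xi>: "\<xi> = (X, A)" by fastforce
  note A = tangentD(1)[OF tangent[unfolded \<xi>]]
  let ?h = "Re (trace (T ** (A ** (T ** A))))" and ?s = "Re (trace (T ** A))"
  let ?Y = "X - U ** (conj_transpose U ** X)" and ?k = "real CARD('k)"
  have h: "0 \<le> ?h" "?s\<^sup>2 \<le> ?k * ?h"
    using A by (rule Re_trace_TATA_nonneg, rule Re_trace_TA_square_le)
  have S_part: "\<alpha> * ?h + \<beta> * ?s\<^sup>2 > 0" if "?h > 0"
  proof (cases "\<beta> \<ge> 0")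
    case True
    then show ?thesis using that alpha_pos by (simp add: add_pos_nonneg)
  next
    case False
    \<comment> \<open>For negative \<beta> the trace inequality gives \<beta> s^2 \<ge> \<beta> k h,
      so the bound on \<beta> is exactly what keeps the sum positive.\<close>
    have "0 < \<alpha> + \<beta> * ?k"
      using beta_gt by (simp add: field_simps)
    then have "0 < (\<alpha> + \<beta> * ?k) * ?h"
      using that by simp
    also have "\<dots> \<le> \<alpha> * ?h + \<beta> * ?s\<^sup>2"
      using mult_left_mono_neg[OF h(2), of \<beta>] False by (simp add: algebra_simps)
    finally show ?thesis .
  qed
  \<comment> \<open>I - 1/2 U U^H = 1/2 I + 1/2 (I - U U^H), and I - U U^H is an orthogonal
    projection, with \<open>?Y\<close> the image of \<open>X\<close>.\<close>
  have "g \<xi> \<xi> = (1/2) * inner X X + (1/2) * inner ?Y ?Y + (\<alpha> * ?h + \<beta> * ?s\<^sup>2)"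
    by (simp add: \<xi> stiefel_hpd_metric_def inner_matrix_eq_Re_trace expand power2_eq_square algebra_simps)
  moreover have "\<alpha> * ?h + \<beta> * ?s\<^sup>2 \<ge> 0"
    using S_part h by (cases "?h = 0") auto
  moreover have "inner X X \<ge> 0" "inner ?Y ?Y \<ge> 0"
    by simp_all
  ultimately have "inner X X = 0" "\<alpha> * ?h + \<beta> * ?s\<^sup>2 = 0"
    using zero by linarith+
  then have "X = 0" "?h = 0"
    using S_part h(1) by (simp, cases "?h = 0", auto)
  then show ?thesis
    using Re_trace_TATA_eq_0[OF A] by (simp add: \<xi> zero_prod_def)
qed

section \<open>The orthogonal projection onto the horizontal space\<close>

lemma horizontal_diff:
  assumes "\<xi> \<in> horizontal_space \<alpha> \<beta> (U, S)" "\<eta> \<in> horizontal_space \<alpha> \<beta> (U, S)"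
  shows "\<xi> - \<eta> \<in> horizontal_space \<alpha> \<beta> (U, S)"
proof -
  obtain X A Y B where [simp]: "\<xi> = (X, A)" "\<eta> = (Y, B)" by fastforce
  have tan: "(X, A) \<in> tangent_space (U, S)" "(Y, B) \<in> tangent_space (U, S)"
    using assms by (simp_all add: horizontal_iff)
  have "(X - Y, A - B) \<in> tangent_space (U, S)"
    using tan[THEN tangentD(1)] tan[THEN tangentD(2)] by (intro tangentI) (simp_all add: expand)
  then show ?thesis
    using assms by (simp add: horizontal_iff expand scaleR_diff_right)
qed

definition rhs :: "complex^'k^'p \<Rightarrow> complex^'k^'k \<Rightarrow> complex^'k^'k" where
  "rhs X A = conj_transpose U ** X + (2 * \<alpha>) *\<^sub>R (A ** T - T ** A)"

lemma rhs_skew_hermitian: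
  assumes "(X, A) \<in> tangent_space (U, S)"
  shows "rhs X A \<in> skew_hermitian"
  using tangentD[OF assms] by (simp add: rhs_def skew_hermitian_def expand algebra_simps)

text \<open>Subtracting the vertical vector of \<Omega> changes U^H X by -\<Omega> and 2\<alpha> (T
  A - A T) by 2\<alpha> (T \<Omega> S + S \<Omega> T - 2 \<Omega>). Equating the two sides of the
  horizontality condition after this change gives precisely the equation for \<Omega>.\<close>

lemma horizontal_part:
  assumes "(X, A) \<in> tangent_space (U, S)" "\<Omega> \<in> skew_hermitian" and "L \<Omega> = rhs X A"
  shows "(X - U ** \<Omega>, A + \<Omega> ** S - S ** \<Omega>) \<in> horizontal_space \<alpha> \<beta> (U, S)"
proof -
  have "conj_transpose U ** X = L \<Omega> - (2 * \<alpha>) *\<^sub>R (A ** T - T ** A)"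
    using assms(3) by (simp add: rhs_def)
  then have "conj_transpose U ** (X - U ** \<Omega>) = (2 * \<alpha>) *\<^sub>R
      (T ** (A + \<Omega> ** S - S ** \<Omega>) - (A + \<Omega> ** S - S ** \<Omega>) ** T)"
    by (simp add: L_def expand vec_eq_iff scaleR_conv_of_real algebra_simps)
  moreover have "(X - U ** \<Omega>, A + \<Omega> ** S - S ** \<Omega>) \<in> tangent_space (U, S)"
    using tangentD[OF assms(1)] assms(2)
    by (intro tangentI) (simp_all add: skew_hermitian_def expand algebra_simps)
  ultimately show ?thesis
    by (simp add: horizontal_iff)
qed

lemma vertical_orthogonal_horizontal:
  assumes "\<Omega> \<in> skew_hermitian" "\<eta> \<in> horizontal_space \<alpha> \<beta> (U, S)"
  shows "g (U ** \<Omega>, S ** \<Omega> - \<Omega> ** S) \<eta> = 0"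
proof -
  have "(U ** \<Omega>, S ** \<Omega> - \<Omega> ** S) \<in> vertical_space (U, S)"
    using assms(1) unfolding vertical_space_def by blast
  then have "g \<eta> (U ** \<Omega>, S ** \<Omega> - \<Omega> ** S) = 0"
    using assms(2) unfolding horizontal_space_def by blast
  then show ?thesis
    by (subst metric_sym)
qed

text \<open>A projection is pinned down on tangent vectors because its difference from the formula
  is horizontal and orthogonal to all horizontal vectors. Conversely, the formula leaves a vertical
  residual and fixes horizontal vectors, which gives orthogonality and surjectivity.\<close>

lemma projection_iff:
  "is_orthogonal_projection g (tangent_space (U, S)) (horizontal_space \<alpha> \<beta> (U, S)) P \<longleftrightarrow>
    (\<forall>X A. (X, A) \<in> tangent_space (U, S) \<longrightarrow> (\<forall>\<Omega> \<in> skew_hermitian.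
      L \<Omega> = rhs X A \<longrightarrow> P (X, A) = (X - U ** \<Omega>, A + \<Omega> ** S - S ** \<Omega>)))"
  (is "?proj \<longleftrightarrow> ?formula")
proof
  assume proj: ?proj
  show ?formula
  proof (intro allI impI ballI)
    fix X A \<Omega>
    assume tan: "(X, A) \<in> tangent_space (U, S)" and \<Omega>: "\<Omega> \<in> skew_hermitian" "L \<Omega> = rhs X A"
    let ?Q = "(X - U ** \<Omega>, A + \<Omega> ** S - S ** \<Omega>)"
    have "P (X, A) - ?Q \<in> horizontal_space \<alpha> \<beta> (U, S)"
      using proj tan horizontal_part[OF tan \<Omega>] unfolding is_orthogonal_projection_def
      by (blast intro: horizontal_diff)
    moreover have "g (P (X, A) - ?Q) \<eta> = 0" if "\<eta> \<in> horizontal_space \<alpha> \<beta> (U, S)" for \<eta>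
    proof -
      \<comment> \<open>The difference is a vertical vector minus the residual of \<open>P\<close>,
        both orthogonal to the horizontal space.\<close>
      have "P (X, A) - ?Q = (U ** \<Omega>, S ** \<Omega> - \<Omega> ** S) - ((X, A) - P (X, A))"
        by (simp add: prod_eq_iff)
      then have "g (P (X, A) - ?Q) \<eta> = g (U ** \<Omega>, S ** \<Omega> - \<Omega> ** S) \<eta> - g ((X, A) - P (X, A)) \<eta>"
        by (metis metric_diff_left)
      moreover have "g ((X, A) - P (X, A)) \<eta> = 0"
        using proj tan that unfolding is_orthogonal_projection_def by blast
      ultimately show ?thesis
        using vertical_orthogonal_horizontal[OF \<Omega>(1) that] by simp
    qed
    \<comment> \<open>Being horizontal, the difference is orthogonal to itself, and definiteness
      applies.\<close>
    ultimately have "P (X, A) - ?Q = 0"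
      unfolding horizontal_space_def by (blast intro: metric_posdef)
    then show "P (X, A) = ?Q" by simp
  qed
next
  assume formula: ?formula
  have P: "\<exists>\<Omega>\<in>skew_hermitian. (X, A) - P (X, A) = (U ** \<Omega>, S ** \<Omega> - \<Omega> ** S) \<and>
      P (X, A) \<in> horizontal_space \<alpha> \<beta> (U, S)" if tan: "(X, A) \<in> tangent_space (U, S)" for X A
  proof -
    obtain \<Omega> where \<Omega>: "\<Omega> \<in> skew_hermitian" "L \<Omega> = rhs X A"
      using ex1_skew_hermitian_L[OF rhs_skew_hermitian[OF tan]] by blast
    then have "P (X, A) = (X - U ** \<Omega>, A + \<Omega> ** S - S ** \<Omega>)"
      using formula tan by blast
    then show ?thesis
      using \<Omega> horizontal_part[OF tan \<Omega>] by (intro bexI[of _ \<Omega>]) simp_all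
  qed
  have fixed: "P (X, A) = (X, A)" if "(X, A) \<in> horizontal_space \<alpha> \<beta> (U, S)" for X A
  proof -
    \<comment> \<open>On a horizontal vector the right-hand side vanishes, so \<Omega> = 0 is a
      solution and the formula returns the vector unchanged.\<close>
    have "L 0 = rhs X A"
      using that by (simp add: horizontal_iff rhs_def L_def expand algebra_simps)
    moreover have "(X, A) \<in> tangent_space (U, S)" "0 \<in> skew_hermitian"
      using that by (simp_all add: horizontal_iff skew_hermitian_def)
    ultimately have "P (X, A) = (X - U ** 0, A + 0 ** S - S ** 0)"
      using formula by blast
    then show ?thesis by (simp add: matrix_mult_distribs)
  qed
  have "P ` tangent_space (U, S) = horizontal_space \<alpha> \<beta> (U, S)"
  proof
    show "P ` tangent_space (U, S) \<subseteq> horizontal_space \<alpha> \<beta> (U, S)"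
      using P by fastforce
    show "horizontal_space \<alpha> \<beta> (U, S) \<subseteq> P ` tangent_space (U, S)"
    proof
      fix \<xi> assume "\<xi> \<in> horizontal_space \<alpha> \<beta> (U, S)"
      then show "\<xi> \<in> P ` tangent_space (U, S)"
        using fixed[of "fst \<xi>" "snd \<xi>"] by (intro image_eqI[of _ _ \<xi>]) (auto simp: horizontal_space_def)
    qed
  qed
  moreover have "g (\<xi> - P \<xi>) \<eta> = 0"
    if "\<xi> \<in> tangent_space (U, S)" "\<eta> \<in> horizontal_space \<alpha> \<beta> (U, S)" for \<xi> \<eta>
    using P[of "fst \<xi>" "snd \<xi>"] that vertical_orthogonal_horizontal[OF _ that(2)] by auto
  ultimately show ?proj
    unfolding is_orthogonal_projection_def by blast
qed

end

theorem proposition1: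
  fixes U :: "complex^'k^'p" and \<Sigma> :: "complex^'k^'k" and \<alpha> \<beta> :: real
  assumes "CARD('k) < CARD('p)"
    and "\<alpha> > 0" and "\<beta> > - \<alpha> / real CARD('k)"
    and "(U, \<Sigma>) \<in> total_space"
  shows
    "horizontal_space \<alpha> \<beta> (U, \<Sigma>) =
       {(\<xi>U, \<xi>S) \<in> tangent_space (U, \<Sigma>).
          conj_transpose U ** \<xi>U = (2 * \<alpha>) *\<^sub>R (matrix_inv \<Sigma> ** \<xi>S - \<xi>S ** matrix_inv \<Sigma>)} \<and>
     (\<forall>\<xi>U \<xi>S. (\<xi>U, \<xi>S) \<in> tangent_space (U, \<Sigma>) \<longrightarrow>
        (\<exists>!\<Omega>. \<Omega> \<in> skew_hermitian \<and>
           (1 - 4 * \<alpha>) *\<^sub>R \<Omega>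
             + (2 * \<alpha>) *\<^sub>R (matrix_inv \<Sigma> ** \<Omega> ** \<Sigma> + \<Sigma> ** \<Omega> ** matrix_inv \<Sigma>)
           = conj_transpose U ** \<xi>U
             + (2 * \<alpha>) *\<^sub>R (\<xi>S ** matrix_inv \<Sigma> - matrix_inv \<Sigma> ** \<xi>S))) \<and>
     (\<forall>P. is_orthogonal_projection (stiefel_hpd_metric \<alpha> \<beta> (U, \<Sigma>))
            (tangent_space (U, \<Sigma>)) (horizontal_space \<alpha> \<beta> (U, \<Sigma>)) P \<longleftrightarrow>
        (\<forall>\<xi>U \<xi>S. (\<xi>U, \<xi>S) \<in> tangent_space (U, \<Sigma>) \<longrightarrow>
           (\<forall>\<Omega> \<in> skew_hermitian.
              (1 - 4 * \<alpha>) *\<^sub>R \<Omega>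
                + (2 * \<alpha>) *\<^sub>R (matrix_inv \<Sigma> ** \<Omega> ** \<Sigma> + \<Sigma> ** \<Omega> ** matrix_inv \<Sigma>)
              = conj_transpose U ** \<xi>U
                + (2 * \<alpha>) *\<^sub>R (\<xi>S ** matrix_inv \<Sigma> - matrix_inv \<Sigma> ** \<xi>S)
              \<longrightarrow> P (\<xi>U, \<xi>S) = (\<xi>U - U ** \<Omega>, \<xi>S + \<Omega> ** \<Sigma> - \<Sigma> ** \<Omega>))))"
proof -
  interpret stiefel_hpd_point U \<Sigma> \<alpha> \<beta>
    using assms by unfold_locales
  show ?thesis
  proof (intro conjI allI impI)
    show "horizontal_space \<alpha> \<beta> (U, \<Sigma>) =
       {(X, A) \<in> tangent_space (U, \<Sigma>).
          conj_transpose U ** X = (2 * \<alpha>) *\<^sub>R (matrix_inv \<Sigma> ** A - A ** matrix_inv \<Sigma>)}"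
      by (simp add: set_eq_iff horizontal_iff)
  qed (fact ex1_skew_hermitian_L[OF rhs_skew_hermitian, unfolded L_def rhs_def]
      projection_iff[unfolded L_def rhs_def])+
qed

end
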